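(* Let $n,r\in\mathbb{N}$ with $r>1$. If $n/2<r$, then the maximum number of rational $r$-term sums in $n$-element sets of irrational numbers is $\mathrm{h}(n,r)= \binom{n-1}{r-1}$. If $n/2=r$, then $\mathrm{h}(n,\frac{n}{2})= 2\binom{n-2}{r-1}$.
   Context: For a finite set $A$ of irrational real numbers and an integer $r>1$, let $\mathcal{H}(A,r)$ denote the set of $r$-element subsets $A'\subseteq A$ for which $\sum_{x\in A'} x\in \mathbb{Q}$. Define $\mathrm{h}(n,r):=\max_{A} |\mathcal{H}(A,r)|$, the maximum being over all sets $A$ of $n$ (distinct) irrational real numbers ($n\ge 1$). Convention: $\binom{a}{b}=0$ if $b>a\ge 0$. *)

theory Defs
  imports "HOL-Analysis.Analysis"
begin

definition rational_sum_subsets :: "real set \<Rightarrow> nat \<Rightarrow> real set set" where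
  "rational_sum_subsets A r = {B. B \<subseteq> A \<and> card B = r \<and> (\<Sum>x\<in>B. x) \<in> \<rat>}"

definition irrational_sets :: "nat \<Rightarrow> real set set" where
  "irrational_sets n = {A. finite A \<and> card A = n \<and> (\<forall>x\<in>A. x \<notin> \<rat>)}"

definition max_rational_sums :: "nat \<Rightarrow> nat \<Rightarrow> nat" where
  "max_rational_sums n r = Max ((\<lambda>A. card (rational_sum_subsets A r)) ` irrational_sets n)"

text \<open>The maximum is over a nonempty finite set of numbers, so \<open>Max\<close> is a genuine maximum.\<close>

lemma irrational_sets_nonempty: "irrational_sets n \<noteq> {}"
proof -
  have "infinite (UNIV - \<rat> :: real set)"
    using uncountable_UNIV_real countable_rat uncountable_minus_countable uncountable_infinite
    by blast
  then obtain A :: "real set" where "finite A" "card A = n" "A \<subseteq> UNIV - \<rat>"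
    using infinite_arbitrarily_large by blast
  then have "A \<in> irrational_sets n"
    by (auto simp: irrational_sets_def)
  then show ?thesis by blast
qed

lemma finite_rational_sum_counts:
  "finite ((\<lambda>A. card (rational_sum_subsets A r)) ` irrational_sets n)"
proof -
  have "card (rational_sum_subsets A r) \<le> n choose r" if "A \<in> irrational_sets n" for A
  proof -
    have A: "finite A" "card A = n" using that by (auto simp: irrational_sets_def)
    have "card (rational_sum_subsets A r) \<le> card {B. B \<subseteq> A \<and> card B = r}"
      using A by (intro card_mono) (auto simp: rational_sum_subsets_def)
    then show ?thesis using A by (simp add: n_subsets)
  qed
  then have "(\<lambda>A. card (rational_sum_subsets A r)) ` irrational_sets n \<subseteq> {..n choose r}"
    by auto
  then show ?thesis using finite_subset by blast
qed

end

theory Submission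
  imports Defs
begin

text \<open>
  Whether a sum is rational depends only on the classes of its terms in the group \<open>\<real>/\<rat>\<close>, and
  this group is torsion-free. The upper bounds come from a statement about an arbitrary abelian
  group: if a family of \<open>m\<close> group elements is not constant, then at most \<open>m - 1 choose k\<close> of its
  \<open>k\<close>-element subfamilies have a prescribed sum when \<open>2 * k < m\<close>, and at most
  \<open>2 * (2 * k - 2 choose (k - 1))\<close> when \<open>m = 2 * k > 0\<close>
  (lemmas \<open>card_sum_sets_le\<close> and \<open>card_sum_sets_middle_le\<close>).

  The proof deletes one member \<open>x\<close> of the family. The subfamilies avoiding \<open>x\<close> and those
  containing \<open>x\<close> are again families with prescribed sum, so Pascal's rule yields the bound by
  induction on \<open>m\<close>, as long as the remaining members are not all equal; that exceptional case is
  counted directly. The induction hypothesis for the subfamilies avoiding \<open>x\<close> is missing precisely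
  when \<open>m = 2 * k + 1\<close>. In that case the \<open>2 * k\<close> remaining members can be split into two
  complementary \<open>k\<close>-element subfamilies in
  \<open>(2 * k choose k) / 2 = 2 * k - 1 choose k\<close> ways, and two complementary subfamilies can both have
  sum \<open>t\<close> only if the remaining members sum to \<open>2 * t\<close>. Since the family is not constant, \<open>x\<close> can be
  chosen to avoid this. The middle case \<open>m = 2 * k\<close> then follows by deleting any one member.

  Replacing sets by their complements turns a bound for \<open>n - r < n / 2\<close> into one for
  \<open>r > n / 2\<close>. A constant family of irrationals gives no rational sum at all, because
  \<open>\<real>/\<rat>\<close> is torsion-free.

  For the lower bounds, take an irrational \<open>a\<close>, \<open>p\<close> numbers congruent to \<open>-(r - 1) * a\<close> modulo
  \<open>\<rat>\<close> and \<open>n - p\<close> numbers congruent to \<open>a\<close>: each \<open>r\<close>-element set with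
  exactly one number of the first kind has a rational sum. The values \<open>p = 1\<close> and \<open>p = 2\<close> attain the two upper bounds.
\<close>

section \<open>Subsets with a prescribed sum modulo a subgroup\<close>

text \<open>The quotient group is represented by congruence modulo \<open>H\<close>, so that \<open>\<real>/\<rat>\<close> needs no type of
  its own.\<close>

locale sum_modulo =
  fixes H :: "'g::ab_group_add set"
  assumes zero_mem: "0 \<in> H"
    and diff_mem: "a \<in> H \<Longrightarrow> b \<in> H \<Longrightarrow> a - b \<in> H"
begin

definition sum_sets :: "('a \<Rightarrow> 'g) \<Rightarrow> 'a set \<Rightarrow> nat \<Rightarrow> 'g \<Rightarrow> 'a set set" where
  "sum_sets f X k t = {B. B \<subseteq> X \<and> card B = k \<and> sum f B - t \<in> H}"

lemma minus_mem: "a \<in> H \<Longrightarrow> - a \<in> H"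
  using diff_mem[OF zero_mem, of a] by simp

lemma add_mem: "a \<in> H \<Longrightarrow> b \<in> H \<Longrightarrow> a + b \<in> H"
  using diff_mem[of a "- b"] minus_mem[of b] by simp

lemma sum_mem: "(\<And>x. x \<in> B \<Longrightarrow> g x \<in> H) \<Longrightarrow> sum g B \<in> H"
  by (induction B rule: infinite_finite_induct) (auto intro: zero_mem add_mem)

lemma finite_sum_sets: "finite X \<Longrightarrow> finite (sum_sets f X k t)"
  by (rule finite_subset[of _ "Pow X"]) (auto simp: sum_sets_def)

lemma card_sum_sets_le_choose:
  assumes "finite X"
  shows "card (sum_sets f X k t) \<le> card X choose k"
proof -
  have "card (sum_sets f X k t) \<le> card {B. B \<subseteq> X \<and> card B = k}"
    using assms by (intro card_mono) (auto simp: sum_sets_def)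
  then show ?thesis using assms by (simp add: n_subsets)
qed

lemma card_sum_sets_delete:
  assumes X: "finite X" and x: "x \<in> X"
  shows "card (sum_sets f X (Suc k) t)
       = card (sum_sets f (X - {x}) (Suc k) t) + card (sum_sets f (X - {x}) k (t - f x))"
proof -
  have ins: "sum f (insert x B) = f x + sum f B \<and> card (insert x B) = Suc (card B)"
    if "B \<subseteq> X - {x}" for B
  proof -
    have "finite B" "x \<notin> B" using that X by (auto intro: finite_subset)
    then show ?thesis by simp
  qed
  have "sum_sets f X (Suc k) t
      = sum_sets f (X - {x}) (Suc k) t \<union> insert x ` sum_sets f (X - {x}) k (t - f x)"
    (is "?L = ?R")
  proof
    show "?L \<subseteq> ?R"
    proof
      fix B assume B: "B \<in> ?L"
      show "B \<in> ?R"
      proof (cases "x \<in> B")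
        case True
        have sub: "B - {x} \<subseteq> X - {x}" and eq: "insert x (B - {x}) = B"
          using B True by (auto simp: sum_sets_def)
        have "B - {x} \<in> sum_sets f (X - {x}) k (t - f x)"
          using B sub ins[OF sub] unfolding eq by (auto simp: sum_sets_def algebra_simps)
        then show ?thesis using eq by (metis UnI2 image_eqI)
      qed (use B in \<open>auto simp: sum_sets_def\<close>)
    qed
    show "?R \<subseteq> ?L"
      using x ins by (auto simp: sum_sets_def algebra_simps)
  qed
  moreover have "inj_on (insert x) (sum_sets f (X - {x}) k (t - f x))"
    by (rule inj_onI) (auto simp: sum_sets_def insert_ident subset_iff)
  moreover have "sum_sets f (X - {x}) (Suc k) t \<inter> insert x ` sum_sets f (X - {x}) k (t - f x) = {}"
    by (auto simp: sum_sets_def)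
  ultimately show ?thesis
    using X by (simp add: card_Un_disjoint finite_sum_sets card_image)
qed

lemma complement_mem_sum_sets:
  assumes X: "finite X" and B: "B \<in> sum_sets f X k t"
  shows "X - B \<in> sum_sets f X (card X - k) (sum f X - t)"
proof -
  have sub: "B \<subseteq> X" and k: "card B = k" and t: "sum f B - t \<in> H"
    using B by (auto simp: sum_sets_def)
  have "sum f (X - B) - (sum f X - t) = - (sum f B - t)"
    using X sub by (simp add: sum_diff algebra_simps)
  then have "sum f (X - B) - (sum f X - t) \<in> H"
    using minus_mem[OF t] by metis
  moreover have "card (X - B) = card X - k"
    using X sub k finite_subset by (subst card_Diff_subset) auto
  ultimately show ?thesis by (auto simp: sum_sets_def)
qed

lemma card_sum_sets_complement_le:
  assumes "finite X"
  shows "card (sum_sets f X k t) \<le> card (sum_sets f X (card X - k) (sum f X - t))"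
proof (rule card_inj_on_le[of "\<lambda>B. X - B"])
  show "inj_on (\<lambda>B. X - B) (sum_sets f X k t)"
    by (rule inj_onI) (auto simp: sum_sets_def)
qed (use assms complement_mem_sum_sets finite_sum_sets in auto)

text \<open>Among a set and its complement at most one sums to \<open>t\<close>, since otherwise the whole would sum to
  \<open>t + t\<close>. So at most half of all \<open>k\<close>-element subsets sum to \<open>t\<close>.\<close>

lemma card_sum_sets_half_le:
  assumes X: "finite X" and card: "card X = 2 * k" and T: "sum f X - (t + t) \<notin> H"
  shows "2 * card (sum_sets f X k t) \<le> 2 * k choose k"
proof -
  let ?S = "sum_sets f X k t"
  let ?C = "(\<lambda>B. X - B) ` ?S"
  have "inj_on (\<lambda>B. X - B) ?S"
    by (rule inj_onI) (auto simp: sum_sets_def)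
  then have cardC: "card ?C = card ?S" by (rule card_image)
  have disj: "?S \<inter> ?C = {}"
  proof (rule ccontr)
    assume "?S \<inter> ?C \<noteq> {}"
    then obtain B where B: "B \<in> ?S" "X - B \<in> ?S" by auto
    have "sum f X = sum f B + sum f (X - B)"
      using B X sum.subset_diff[of B X f] by (simp add: sum_sets_def add.commute)
    then have "sum f X - (t + t) = (sum f B - t) + (sum f (X - B) - t)"
      by (simp add: algebra_simps)
    also have "\<dots> \<in> H"
      using B unfolding sum_sets_def by (blast intro: add_mem)
    finally show False using T by simp
  qed
  have sub: "?S \<union> ?C \<subseteq> {B. B \<subseteq> X \<and> card B = k}"
    using complement_mem_sum_sets[OF X] card by (auto simp: sum_sets_def)
  have "card (?S \<union> ?C) \<le> card X choose k"
    using card_mono[OF _ sub] X by (simp add: n_subsets)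
  then show ?thesis
    using disj cardC X card by (simp add: card_Un_disjoint finite_sum_sets)
qed

lemma sum_cong_of_constant:
  assumes const: "\<And>y z. y \<in> Y \<Longrightarrow> z \<in> Y \<Longrightarrow> f y - f z \<in> H"
    and "finite B" "finite C" "B \<subseteq> Y" "C \<subseteq> Y" "card B = card C"
  shows "sum f B - sum f C \<in> H"
proof -
  obtain h where h: "bij_betw h B C"
    using assms finite_same_card_bij by blast
  have "sum f B - sum f C = (\<Sum>b\<in>B. f b - f (h b))"
    using sum.reindex_bij_betw[OF h, of f] by (simp add: sum_subtractf)
  also have "\<dots> \<in> H"
    using assms bij_betwE[OF h] by (intro sum_mem const) auto
  finally show ?thesis .
qed

text \<open>If \<open>x\<close> is the only exceptional member, exchanging \<open>x\<close> for another member changes the sum, while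
  all other exchanges preserve it. Hence either every subset with sum \<open>t\<close> contains \<open>x\<close> or none does.\<close>

lemma card_sum_sets_one_exception:
  assumes X: "finite X" and x: "x \<in> X"
    and const: "\<And>y z. y \<in> X - {x} \<Longrightarrow> z \<in> X - {x} \<Longrightarrow> f y - f z \<in> H"
    and exc: "y \<in> X" "z \<in> X" "f y - f z \<notin> H"
  shows "card (sum_sets f X (Suc k) t) \<le> max ((card X - 1) choose Suc k) ((card X - 1) choose k)"
proof -
  let ?Y = "X - {x}"
  have x_exc: "f x - f w \<notin> H" if w: "w \<in> ?Y" for w
  proof
    assume *: "f x - f w \<in> H"
    have **: "f u - f w \<in> H" if "u \<in> X" for u
      using const[OF _ w] * that by (cases "u = x") auto
    have "f y - f z \<in> H" using diff_mem[OF **[OF exc(1)] **[OF exc(2)]] by simp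
    then show False using exc by simp
  qed
  have "sum_sets f ?Y (Suc k) t = {} \<or> sum_sets f ?Y k (t - f x) = {}"
  proof (rule ccontr)
    assume "\<not> ?thesis"
    then obtain B C where B: "B \<in> sum_sets f ?Y (Suc k) t" and C: "C \<in> sum_sets f ?Y k (t - f x)"
      by auto
    have sub: "B \<subseteq> ?Y" "C \<subseteq> ?Y" using B C by (auto simp: sum_sets_def)
    have fin: "finite B" "finite C" using sub X by (auto intro: finite_subset)
    obtain w where w: "w \<in> B" using B by (auto simp: sum_sets_def card_Suc_eq)
    have "sum f (B - {w}) - sum f C \<in> H"
      using B C w fin sub by (intro sum_cong_of_constant[OF const]) (auto simp: sum_sets_def)
    moreover have "sum f (B - {w}) = sum f B - f w"
      using fin w by (simp add: sum_diff1)
    moreover have "(sum f B - t) - (sum f C - (t - f x)) \<in> H"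
      using B C unfolding sum_sets_def by (blast intro: diff_mem)
    ultimately have "(sum f B - f w - sum f C) - ((sum f B - t) - (sum f C - (t - f x))) \<in> H"
      using diff_mem by metis
    moreover have "(sum f B - f w - sum f C) - ((sum f B - t) - (sum f C - (t - f x))) = f x - f w"
      by (simp add: algebra_simps)
    ultimately have "f x - f w \<in> H" by metis
    then show False using x_exc w sub by auto
  qed
  then show ?thesis
    using card_sum_sets_delete[OF X x, of f k t]
      card_sum_sets_le_choose[of ?Y f "Suc k" t] card_sum_sets_le_choose[of ?Y f k "t - f x"] X x
    by (auto simp: le_max_iff_disj)
qed

section \<open>Upper bounds for a nonconstant family\<close>

lemma card_sum_sets_le:
  assumes "finite X" "2 * k < card X" "\<exists>y\<in>X. \<exists>z\<in>X. f y - f z \<notin> H"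
  shows "card (sum_sets f X k t) \<le> (card X - 1) choose k"
  using assms
proof (induction "card X" arbitrary: X k t rule: less_induct)
  case less
  show ?case
  proof (cases k)
    case 0
    then show ?thesis using card_sum_sets_le_choose[OF less.prems(1), of f k t] by simp
  next
    case (Suc j)
    obtain y z where yz: "y \<in> X" "z \<in> X" "f y - f z \<notin> H" using less.prems by blast
    \<comment> \<open>Modulo \<open>H\<close>, the deleted member must differ from \<open>sum f X - 2 * t\<close>; one of two incongruent
      members does.\<close>
    have "\<exists>x\<in>X. sum f X - f x - (t + t) \<notin> H"
    proof (rule ccontr)
      assume "\<not> ?thesis"
      then have "(sum f X - f z - (t + t)) - (sum f X - f y - (t + t)) \<in> H"
        using yz by (blast intro: diff_mem)
      then show False using yz by (simp add: algebra_simps)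
    qed
    then obtain x where x: "x \<in> X" "sum f X - f x - (t + t) \<notin> H" by blast
    let ?Y = "X - {x}"
    have Y: "finite ?Y" "card ?Y = card X - 1" "card ?Y < card X"
      using less.prems x by (auto simp: card_gt_0_iff)
    have big: "2 * Suc j \<le> card X - 1" using less.prems Suc by simp
    show ?thesis
    proof (cases "\<exists>y\<in>?Y. \<exists>z\<in>?Y. f y - f z \<notin> H")
      case False
      have "(card X - 1) choose j \<le> (card X - 1) choose Suc j"
        using big by (intro binomial_mono) auto
      then show ?thesis
        using card_sum_sets_one_exception[OF less.prems(1) x(1) _ yz, of j t] False Suc by auto
    next
      case True
      have with_x: "card (sum_sets f ?Y j (t - f x)) \<le> (card ?Y - 1) choose j"
        using less.hyps[OF Y(3,1) _ True] big Y by simp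
      have without_x: "card (sum_sets f ?Y (Suc j) t) \<le> (card ?Y - 1) choose Suc j"
      proof (cases "2 * Suc j < card ?Y")
        case True': True
        show ?thesis using less.hyps[OF Y(3,1) True' True] .
      next
        case False
        then have m: "card ?Y = 2 * Suc j" using big Y by simp
        have "sum f ?Y = sum f X - f x"
          using less.prems x by (simp add: sum_diff1)
        then have "2 * card (sum_sets f ?Y (Suc j) t) \<le> 2 * Suc j choose Suc j"
          using card_sum_sets_half_le[OF Y(1) m, of f t] x by simp
        also have "\<dots> = (2 * j + 1 choose j) + (2 * j + 1 choose Suc j)"
          by simp
        also have "2 * j + 1 choose j = 2 * j + 1 choose Suc j"
          by (subst binomial_symmetric) auto
        finally show ?thesis using m by simp
      qed
      have "card X - 1 = Suc (card ?Y - 1)" using big Y by simp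
      then show ?thesis
        using card_sum_sets_delete[OF less.prems(1) x(1), of f j t] with_x without_x Suc by simp
    qed
  qed
qed

lemma card_sum_sets_le_large:
  assumes X: "finite X" and k: "card X < 2 * k" "k \<le> card X"
    and nonconst: "\<exists>y\<in>X. \<exists>z\<in>X. f y - f z \<notin> H"
  shows "card (sum_sets f X k t) \<le> (card X - 1) choose (k - 1)"
proof -
  have "card (sum_sets f X k t) \<le> card (sum_sets f X (card X - k) (sum f X - t))"
    by (rule card_sum_sets_complement_le[OF X])
  also have "\<dots> \<le> (card X - 1) choose (card X - k)"
    using k by (intro card_sum_sets_le[OF X _ nonconst]) auto
  also have "\<dots> = (card X - 1) choose (k - 1)"
    using k by (subst binomial_symmetric) auto
  finally show ?thesis .
qed

lemma card_sum_sets_middle_le: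
  assumes X: "finite X" and card: "card X = 2 * k" and k: "k > 0"
    and nonconst: "\<exists>y\<in>X. \<exists>z\<in>X. f y - f z \<notin> H"
  shows "card (sum_sets f X k t) \<le> 2 * ((2 * k - 2) choose (k - 1))"
proof -
  obtain j where j: "k = Suc j" using k by (cases k) auto
  obtain x y where x: "x \<in> X" and y: "y \<in> X" and xy: "f x - f y \<notin> H" using nonconst by blast
  let ?Y = "X - {x}"
  have Y: "finite ?Y" "card ?Y = 2 * j + 1" using X x card j by auto
  show ?thesis
  proof (cases "\<exists>y\<in>?Y. \<exists>z\<in>?Y. f y - f z \<notin> H")
    case True
    have "card (sum_sets f ?Y (Suc j) t) \<le> 2 * j choose j"
      using card_sum_sets_le_large[OF Y(1) _ _ True, of "Suc j" t] Y by simp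
    moreover have "card (sum_sets f ?Y j (t - f x)) \<le> 2 * j choose j"
      using card_sum_sets_le[OF Y(1) _ True, of j "t - f x"] Y by simp
    ultimately show ?thesis
      using card_sum_sets_delete[OF X x, of f j t] j by simp
  next
    case False
    have sym: "2 * j + 1 choose Suc j = 2 * j + 1 choose j"
      by (subst binomial_symmetric) auto
    have "card (sum_sets f X k t) \<le> 2 * j + 1 choose Suc j"
      using card_sum_sets_one_exception[OF X x _ x y xy, of j t] False j card sym by auto
    also have "\<dots> = (2 * j choose j) + (2 * j choose Suc j)"
      by simp
    also have "\<dots> \<le> 2 * (2 * j choose j)"
      using binomial_maximum'[of j "Suc j"] by simp
    finally show ?thesis using j by simp
  qed
qed

end

section \<open>Rational sums of irrational numbers\<close>

interpretation rational: sum_modulo "\<rat> :: real set"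
  by unfold_locales auto

lemma rational_sum_subsets_eq: "rational_sum_subsets A r = rational.sum_sets (\<lambda>x. x) A r 0"
  by (auto simp: rational_sum_subsets_def rational.sum_sets_def)

text \<open>If all members of \<open>A\<close> are congruent to \<open>a\<close>, every \<open>r\<close>-term sum is congruent to \<open>r * a\<close>, which is
  irrational.\<close>

lemma incongruent_members:
  assumes A: "\<forall>x\<in>A. x \<notin> \<rat>" and r: "r > 0" and B: "B \<in> rational_sum_subsets A r"
  shows "\<exists>y\<in>A. \<exists>z\<in>A. y - z \<notin> \<rat>"
proof (rule ccontr)
  assume const: "\<not> ?thesis"
  have B': "B \<subseteq> A" "card B = r" "(\<Sum>x\<in>B. x) \<in> \<rat>"
    using B by (auto simp: rational_sum_subsets_def)
  obtain a where a: "a \<in> B" using B' r by (metis card_gt_0_iff ex_in_conv)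
  have "(\<Sum>x\<in>B. x - a) \<in> \<rat>"
    using const B' a by (intro rational.sum_mem) auto
  then have "(\<Sum>x\<in>B. x) - (\<Sum>x\<in>B. x - a) \<in> \<rat>"
    using B' by simp
  then have "real r * a \<in> \<rat>"
    using B' by (simp add: sum_subtractf)
  then have "real r * a / real r \<in> \<rat>" by (rule Rats_divide) simp
  then show False using A a B' r by auto
qed

lemma card_rational_sum_subsets_le:
  assumes A: "A \<in> irrational_sets n" and r: "r > 0" and n: "n < 2 * r"
  shows "card (rational_sum_subsets A r) \<le> (n - 1) choose (r - 1)"
proof (cases "rational_sum_subsets A r = {}")
  case False
  have A': "finite A" "card A = n" "\<forall>x\<in>A. x \<notin> \<rat>" using A by (auto simp: irrational_sets_def)
  obtain B where B: "B \<in> rational_sum_subsets A r" using False by blast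
  then have "r \<le> card A" using card_mono[of A B] A' by (auto simp: rational_sum_subsets_def)
  then show ?thesis
    using rational.card_sum_sets_le_large[OF A'(1) _ _ incongruent_members[OF A'(3) r B], of r 0]
      A' n by (simp add: rational_sum_subsets_eq)
qed simp

lemma card_rational_sum_subsets_middle_le:
  assumes A: "A \<in> irrational_sets (2 * r)" and r: "r > 0"
  shows "card (rational_sum_subsets A r) \<le> 2 * ((2 * r - 2) choose (r - 1))"
proof (cases "rational_sum_subsets A r = {}")
  case False
  have A': "finite A" "card A = 2 * r" "\<forall>x\<in>A. x \<notin> \<rat>" using A by (auto simp: irrational_sets_def)
  obtain B where B: "B \<in> rational_sum_subsets A r" using False by blast
  show ?thesis
    using rational.card_sum_sets_middle_le[OF A'(1,2) r incongruent_members[OF A'(3) r B], of 0]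
    by (simp add: rational_sum_subsets_eq)
qed simp

text \<open>Adding different integers makes the members distinct without changing their classes
  modulo \<open>\<rat>\<close>.\<close>

lemma ex_many_rational_sums:
  assumes p: "p \<le> n" and r: "r > 1"
  shows "\<exists>A \<in> irrational_sets n. p * ((n - p) choose (r - 1)) \<le> card (rational_sum_subsets A r)"
proof -
  obtain a :: real where a: "a \<notin> \<rat>"
    using irrational_sets_nonempty[of 1] by (auto simp: irrational_sets_def card_1_singleton_iff)
  define S where "S = (\<lambda>i. real i - real (r - 1) * a) ` {..<p}"
  define L where "L = (\<lambda>i. real i + a) ` {..<n - p}"
  have fin: "finite S" "finite L" by (auto simp: S_def L_def)
  have card: "card S = p" "card L = n - p"
    by (auto simp: S_def L_def card_image inj_on_def)
  have S: "(\<And>s. s \<in> S \<Longrightarrow> s + real (r - 1) * a \<in> \<rat>)" by (auto simp: S_def)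
  have L: "(\<And>l. l \<in> L \<Longrightarrow> l - a \<in> \<rat>)" by (auto simp: L_def)
  have mult: "real k * a \<notin> \<rat>" if "k > 0" for k
  proof
    assume "real k * a \<in> \<rat>"
    then have "real k * a / real k \<in> \<rat>" by (rule Rats_divide) simp
    then show False using a that by simp
  qed
  have irrS: "s \<notin> \<rat>" if "s \<in> S" for s
  proof
    assume "s \<in> \<rat>"
    then have "(s + real (r - 1) * a) - s \<in> \<rat>" using S[OF that] by (intro Rats_diff)
    then show False using mult[of "r - 1"] r by simp
  qed
  have irrL: "l \<notin> \<rat>" if "l \<in> L" for l
  proof
    assume "l \<in> \<rat>"
    from Rats_diff[OF this L[OF that]] show False using a by simp
  qed
  have disj: "S \<inter> L = {}"
  proof (rule ccontr)
    assume "S \<inter> L \<noteq> {}"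
    then obtain x where "x \<in> S" "x \<in> L" by blast
    then have "(x + real (r - 1) * a) - (x - a) \<in> \<rat>" using Rats_diff[OF S L] by blast
    moreover have "(x + real (r - 1) * a) - (x - a) = real r * a"
      using r by (simp add: algebra_simps of_nat_diff)
    ultimately show False using mult[of r] r by simp
  qed
  let ?K = "{C. C \<subseteq> L \<and> card C = r - 1}"
  have A: "S \<union> L \<in> irrational_sets n"
    using fin card disj p irrS irrL by (auto simp: irrational_sets_def card_Un_disjoint)
  have "card (S \<times> ?K) \<le> card (rational_sum_subsets (S \<union> L) r)"
  proof (rule card_inj_on_le[of "\<lambda>(s, C). insert s C"])
    show "inj_on (\<lambda>(s, C). insert s C) (S \<times> ?K)"
    proof (rule inj_onI, clarify)
      fix s C s' C'
      assume *: "s \<in> S" "s' \<in> S" "C \<subseteq> L" "C' \<subseteq> L" "insert s C = insert s' C'"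
      \<comment> \<open>Intersecting with \<open>S\<close> and with \<open>L\<close> recovers the two components.\<close>
      have "{s} = insert s C \<inter> S" "{s'} = insert s' C' \<inter> S"
        "C = insert s C \<inter> L" "C' = insert s' C' \<inter> L"
        using * disj by auto
      then show "s = s' \<and> C = C'" using *(5) by (metis singleton_inject)
    qed
    show "(\<lambda>(s, C). insert s C) ` (S \<times> ?K) \<subseteq> rational_sum_subsets (S \<union> L) r"
    proof clarify
      fix s C assume s: "s \<in> S" and C: "C \<subseteq> L" "card C = r - 1"
      have fC: "finite C" "s \<notin> C" using C fin disj s by (auto intro: finite_subset)
      have "(\<Sum>x\<in>insert s C. x) = (s + real (r - 1) * a) + (\<Sum>x\<in>C. x - a)"
        using fC C by (simp add: sum_subtractf)
      also have "\<dots> \<in> \<rat>"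
        using C by (intro Rats_add[OF S[OF s]] rational.sum_mem L) auto
      finally show "insert s C \<in> rational_sum_subsets (S \<union> L) r"
        using s C fC r by (auto simp: rational_sum_subsets_def)
    qed
    show "finite (rational_sum_subsets (S \<union> L) r)"
      using fin by (simp add: rational_sum_subsets_eq rational.finite_sum_sets)
  qed
  then have "p * ((n - p) choose (r - 1)) \<le> card (rational_sum_subsets (S \<union> L) r)"
    using fin card by (simp add: card_cartesian_product n_subsets)
  then show ?thesis using A by blast
qed

lemma max_rational_sums_eqI:
  assumes upper: "\<And>A. A \<in> irrational_sets n \<Longrightarrow> card (rational_sum_subsets A r) \<le> M"
    and lower: "\<exists>A \<in> irrational_sets n. M \<le> card (rational_sum_subsets A r)"
  shows "max_rational_sums n r = M"
proof -
  obtain A where "A \<in> irrational_sets n" "card (rational_sum_subsets A r) = M"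
    using lower upper by (meson le_antisym)
  then show ?thesis
    unfolding max_rational_sums_def using upper
    by (intro Max_eqI finite_rational_sum_counts) auto
qed

theorem theorem1p7:
  fixes n r :: nat
  assumes "n \<ge> 1" and "r > 1"
  shows "(real n / 2 < real r \<longrightarrow> max_rational_sums n r = (n - 1) choose (r - 1)) \<and>
         (real n / 2 = real r \<longrightarrow> max_rational_sums n r = 2 * ((n - 2) choose (r - 1)))"
proof (intro conjI impI)
  assume "real n / 2 < real r"
  then have n: "n < 2 * r" by linarith
  show "max_rational_sums n r = (n - 1) choose (r - 1)"
  proof (rule max_rational_sums_eqI)
    show "card (rational_sum_subsets A r) \<le> (n - 1) choose (r - 1)"
      if "A \<in> irrational_sets n" for A
      using card_rational_sum_subsets_le[OF that _ n] assms by simp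
    show "\<exists>A \<in> irrational_sets n. (n - 1) choose (r - 1) \<le> card (rational_sum_subsets A r)"
      using ex_many_rational_sums[of 1 n r] assms by simp
  qed
next
  assume "real n / 2 = real r"
  then have n: "n = 2 * r" by linarith
  show "max_rational_sums n r = 2 * ((n - 2) choose (r - 1))"
  proof (rule max_rational_sums_eqI)
    show "card (rational_sum_subsets A r) \<le> 2 * ((n - 2) choose (r - 1))"
      if "A \<in> irrational_sets n" for A
      using card_rational_sum_subsets_middle_le[of A r] that assms n by simp
    show "\<exists>A \<in> irrational_sets n. 2 * ((n - 2) choose (r - 1)) \<le> card (rational_sum_subsets A r)"
      using ex_many_rational_sums[of 2 n r] assms n by simp
  qed
qed

end
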